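(* Let $\mathcal{K}$ be a simplicial complex on $m$ vertices and $p$ a prime number. The following inequalities hold: $$m-\gamma(\mathcal{K})\le s(\mathcal{K})\le s_p(\mathcal{K})\le m-\dim\mathcal{K}-1.$$
   Context: A simplicial map is nondegenerate if it is injective on the vertex set of each simplex. For $\mathbf{k}=\mathbb{Z}$ or $\mathbf{k}=\mathbb{F}_p$, $K(\mathbf{k}^r)$ is the simplicial complex whose vertices are the lines in $\mathbf{k}^r$ (rank-one submodules that are direct summands of $\mathbf{k}^r$) and whose simplices are the sets of lines $\{l_1,\dots,l_k\}$ whose span is a direct summand of $\mathbf{k}^r$ of rank $k$. For a simplicial complex $\mathcal{K}$ on $m$ vertices: the (complex) Buchstaber invariant $s(\mathcal{K})$ is $m-r$ with $r$ the least integer such that there is a nondegenerate simplicial map $\mathcal{K}\to K(\mathbb{Z}^r)$ (equivalently, $s(\mathcal{K})$ is the maximal dimension of a toric subgroup of $T^m$ acting freely on the moment angle complex $\mathcal{Z}_{\mathcal{K}}$); the mod $p$ Buchstaber invariant $s_p(\mathcal{K})$ is $m-r$ with $r$ the least integer such that there is a nondegenerate simplicial map $\mathcal{K}\to K(\mathbb{F}_p^r)$. The chromatic number $\gamma(\mathcal{K})$ is the least integer such that there is a nondegenerate simplicial map $\mathcal{K}\to\Delta^{\gamma(\mathcal{K})-1}$, where $\Delta^{d}$ is the full $d$-dimensional simplex. *)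

theory Defs
  imports
    "Jordan_Normal_Form.Missing_VectorSpace"
    "HOL-Algebra.IntRing"
    "HOL-Number_Theory.Residues"
begin

section \<open>Abstract simplicial complexes\<close>

text \<open>
  A complex is given by its set of simplices, the empty simplex included. Its vertices are the
  points that occur in some simplex, so there are no ghost vertices: \<open>{v}\<close> is a simplex for
  every vertex \<open>v\<close>. The complex itself may be infinite, since the complexes \<open>K(\<int>\<^sup>r)\<close> are.
\<close>

definition abstract_simplicial_complex :: "'a set set \<Rightarrow> bool" where
  "abstract_simplicial_complex K \<longleftrightarrow>
     {} \<in> K \<and> (\<forall>\<sigma>\<in>K. finite \<sigma>) \<and> (\<forall>\<sigma>\<in>K. \<forall>\<tau>. \<tau> \<subseteq> \<sigma> \<longrightarrow> \<tau> \<in> K)"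

definition vertices :: "'a set set \<Rightarrow> 'a set" where
  "vertices K = \<Union>K"

text \<open>Integer valued, because the complex \<open>{{}}\<close> has dimension \<open>-1\<close>. Meant for finite complexes.\<close>

definition complex_dim :: "'a set set \<Rightarrow> int" where
  "complex_dim K = Max ((\<lambda>\<sigma>. int (card \<sigma>) - 1) ` K)"

definition simplicial_map :: "'a set set \<Rightarrow> 'b set set \<Rightarrow> ('a \<Rightarrow> 'b) \<Rightarrow> bool" where
  "simplicial_map K L f \<longleftrightarrow> f ` vertices K \<subseteq> vertices L \<and> (\<forall>\<sigma>\<in>K. f ` \<sigma> \<in> L)"

definition nondegenerate_simplicial_map :: "'a set set \<Rightarrow> 'b set set \<Rightarrow> ('a \<Rightarrow> 'b) \<Rightarrow> bool" where
  "nondegenerate_simplicial_map K L f \<longleftrightarrow> simplicial_map K L f \<and> (\<forall>\<sigma>\<in>K. inj_on f \<sigma>)"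

text \<open>The full simplex on \<open>n\<close> vertices, that is, \<open>\<Delta>\<^sup>n\<^sup>-\<^sup>1\<close>.\<close>

definition full_simplex :: "nat \<Rightarrow> nat set set" where
  "full_simplex n = Pow {..<n}"

definition chromatic_number :: "'a set set \<Rightarrow> nat" where
  "chromatic_number K = (LEAST n. \<exists>f. nondegenerate_simplicial_map K (full_simplex n) f)"


section \<open>The complexes of lines in a free module\<close>

context Module.module
begin

definition direct_summand :: "'c set \<Rightarrow> bool" where
  "direct_summand N \<longleftrightarrow> submodule R N M \<and>
     (\<exists>N'. submodule R N' M \<and> N \<inter> N' = {\<zero>\<^bsub>M\<^esub>} \<and> submodule_sum N N' = carrier M)"

text \<open>
  \<open>N\<close> is free of rank \<open>k\<close>. Submodules of \<open>R\<^sup>r\<close> are free when \<open>R\<close> is \<open>\<int>\<close> or a field,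
  and then this is the usual notion of rank.
\<close>

definition has_rank :: "'c set \<Rightarrow> nat \<Rightarrow> bool" where
  "has_rank N k \<longleftrightarrow> (\<exists>B. finite B \<and> card B = k \<and> B \<subseteq> carrier M \<and> lin_indpt B \<and> span B = N)"

definition lines :: "'c set set" where
  "lines = {l. direct_summand l \<and> has_rank l 1}"

definition line_complex :: "'c set set set" where
  "line_complex = {S. finite S \<and> S \<subseteq> lines \<and>
     direct_summand (span (\<Union>S)) \<and> has_rank (span (\<Union>S)) (card S)}"

end

text \<open>\<open>K(R\<^sup>r)\<close>, where \<open>R\<^sup>r\<close> is the module of functions from \<open>{..<r}\<close> to \<open>R\<close>.\<close>

definition universal_complex :: "('a, 'b) ring_scheme \<Rightarrow> nat \<Rightarrow> (nat \<Rightarrow> 'a) set set set" where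
  "universal_complex R r = module.line_complex R (ring.func_space R {..<r})"


section \<open>Buchstaber invariants\<close>

definition buchstaber_over :: "('r, 'b) ring_scheme \<Rightarrow> 'a set set \<Rightarrow> int" where
  "buchstaber_over R K = int (card (vertices K)) -
     int (LEAST r. \<exists>f. nondegenerate_simplicial_map K (universal_complex R r) f)"

definition buchstaber :: "'a set set \<Rightarrow> int" where
  "buchstaber K = buchstaber_over int_ring K"

definition mod_buchstaber :: "nat \<Rightarrow> 'a set set \<Rightarrow> int" where
  "mod_buchstaber p K = buchstaber_over (residue_ring (int p)) K"

end

theory Submission
  imports Defs
begin

text \<open>
  Each inequality compares the numbers \<open>r\<close> for which \<open>K\<close> maps nondegenerately to a given
  complex. Sending the vertices of \<open>\<Delta>\<^sup>r\<^sup>-\<^sup>1\<close> to the coordinate lines of \<open>\<int>\<^sup>r\<close> is a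
  nondegenerate map \<open>\<Delta>\<^sup>r\<^sup>-\<^sup>1 \<rightarrow> K(\<int>\<^sup>r)\<close>. Reduction mod \<open>p\<close> is a nondegenerate map
  \<open>K(\<int>\<^sup>r) \<rightarrow> K(F\<^sub>p\<^sup>r)\<close>: a direct summand \<open>N\<close> satisfies \<open>N \<inter> p\<int>\<^sup>r = pN\<close>, so reduction
  preserves its rank and maps complements to complements. Finally a simplex of
  \<open>K(F\<^sub>p\<^sup>r)\<close> with \<open>k\<close> vertices spans a subspace of dimension \<open>k\<close>, so that \<open>k \<le> r\<close>.
\<close>

section \<open>Spans and direct summands in a module with a finite basis\<close>

lemma (in abelian_group) add_minus_cancel_left:
  assumes "x \<in> carrier G" "y \<in> carrier G"
  shows "(x \<oplus> y) \<ominus> x = y"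
  using assms by (simp add: a_minus_def a_comm[of x y] a_assoc r_neg)

context Module.module
begin

lemma submodule_sumE:
  assumes "v \<in> submodule_sum N N'"
  obtains n n' where "n \<in> N" "n' \<in> N'" "v = n \<oplus>\<^bsub>M\<^esub> n'"
  using assms by (auto simp: submodule_sum_def)

lemma submodule_minus_closed:
  assumes "submodule R N M" "v \<in> N" "w \<in> N"
  shows "v \<ominus>\<^bsub>M\<^esub> w \<in> N"
proof -
  interpret N: LinearCombinations.submodule R N M by fact
  have "\<ominus>\<^bsub>M\<^esub> w = (\<ominus>\<^bsub>R\<^esub> \<one>\<^bsub>R\<^esub>) \<odot>\<^bsub>M\<^esub> w"
    using assms N.subset by (simp add: smult_minus_1 subsetD)
  with assms show ?thesis by (simp add: a_minus_def)
qed

text \<open>A simplex of \<open>line_complex\<close> is judged by the span of a union of lines; this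
  replaces that span by the span of chosen generators of the lines.\<close>

lemma span_Union_spans:
  assumes "S \<subseteq> carrier M"
  shows "span (\<Union>v\<in>S. span {v}) = span S"
proof
  have "(\<Union>v\<in>S. span {v}) \<subseteq> span S"
    using span_is_monotone[of "{_}" S] by blast
  then show "span (\<Union>v\<in>S. span {v}) \<subseteq> span S"
    by (rule span_is_subset) (rule span_is_submodule[OF assms])
  have "S \<subseteq> (\<Union>v\<in>S. span {v})"
    using in_own_span[of "{_}"] assms by blast
  then show "span S \<subseteq> span (\<Union>v\<in>S. span {v})"
    by (rule span_is_monotone)
qed

text \<open>Subtracting an expansion of \<open>x\<close> over \<open>T\<close> from one over
  \<open>S\<close> gives a single relation on \<open>S \<union> T\<close>. As the two sets are
  disjoint, its coefficients on \<open>S\<close> are those of the first expansion, and independence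
  of \<open>B\<close> makes them vanish.\<close>

lemma span_Int_span_disjoint:
  assumes "finite B" "B \<subseteq> carrier M" "lin_indpt B" "S \<subseteq> B" "T \<subseteq> B" "S \<inter> T = {}"
  shows "span S \<inter> span T = {\<zero>\<^bsub>M\<^esub>}"
proof -
  have fin: "finite S" "finite T" and sub: "S \<subseteq> carrier M" "T \<subseteq> carrier M"
    using assms finite_subset by blast+
  have "x = \<zero>\<^bsub>M\<^esub>" if xS: "x \<in> span S" and xT: "x \<in> span T" for x
  proof -
    obtain a where a: "a \<in> S \<rightarrow> carrier R" "lincomb a S = x"
      using finite_in_span[OF fin(1) sub(1) xS] by blast
    obtain b where b: "b \<in> T \<rightarrow> carrier R" "lincomb b T = x"
      using finite_in_span[OF fin(2) sub(2) xT] by blast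
    define b' where "b' = (\<lambda>v. (\<ominus>\<^bsub>R\<^esub> \<one>\<^bsub>R\<^esub>) \<otimes>\<^bsub>R\<^esub> b v)"
    have b': "b' \<in> T \<rightarrow> carrier R" using b(1) by (auto simp: b'_def)
    have xc: "x \<in> carrier M" using a sub by auto
    have "lincomb b' T = (\<ominus>\<^bsub>R\<^esub> \<one>\<^bsub>R\<^esub>) \<odot>\<^bsub>M\<^esub> x"
      unfolding b'_def using b sub by (subst lincomb_smult) auto
    then have bx: "lincomb b' T = \<ominus>\<^bsub>M\<^esub> x"
      using xc by (simp add: smult_minus_1)
    define c where "c = (\<lambda>v. if v \<in> S then a v else b' v)"
    have "lincomb c (S \<union> T) = lincomb a S \<oplus>\<^bsub>M\<^esub> lincomb b' T"
      unfolding c_def using fin sub assms(6) a(1) b' by (subst lincomb_union2) auto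
    then have c0: "lincomb c (S \<union> T) = \<zero>\<^bsub>M\<^esub>"
      using a bx xc by (simp add: M.r_neg)
    have cc: "c \<in> S \<union> T \<rightarrow> carrier R"
      using a(1) b' by (auto simp: c_def)
    have "c v = \<zero>\<^bsub>R\<^esub>" if "v \<in> S" for v
      using lin_dep_crit[of "S \<union> T" B c v] fin assms(3-5) cc c0 that by blast
    then have "a \<in> S \<rightarrow> {\<zero>\<^bsub>R\<^esub>}" by (auto simp: c_def)
    then show ?thesis using a(2) lincomb_zero sub by blast
  qed
  moreover have "\<zero>\<^bsub>M\<^esub> \<in> span S" "\<zero>\<^bsub>M\<^esub> \<in> span T"
    using span_is_submodule sub LinearCombinations.submodule.zero_closed by blast+
  ultimately show ?thesis by blast
qed

text \<open>The remaining basis vectors \<open>B - S\<close> span a complement.\<close>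

lemma direct_summand_span_subset_basis:
  assumes "finite B" "B \<subseteq> carrier M" "lin_indpt B" "gen_set B" "S \<subseteq> B"
  shows "direct_summand (span S)"
proof -
  have sub: "S \<subseteq> carrier M" "B - S \<subseteq> carrier M" using assms by auto
  have "submodule_sum (span S) (span (B - S)) = span (S \<union> (B - S))"
    using span_union_is_sum[OF sub] by simp
  also have "\<dots> = carrier M" using assms by (simp add: Un_absorb1)
  finally show ?thesis
    unfolding direct_summand_def
    using span_is_submodule[OF sub(1)] span_is_submodule[OF sub(2)]
      span_Int_span_disjoint[OF assms(1-3), of S "B - S"] assms(5) by blast
qed

lemma has_rank_span:
  assumes "finite S" "S \<subseteq> carrier M" "lin_indpt S"
  shows "has_rank (span S) (card S)"
  unfolding has_rank_def using assms by blast

text \<open>Every subset of a basis spans a direct summand of the expected rank, so the lines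
  through basis vectors form a full simplex. They are distinct because two equal ones would meet
  only in zero, while a basis vector is nonzero as soon as the ring is nontrivial.\<close>

lemma nondegenerate_span_basis:
  assumes "finite B" "B \<subseteq> carrier M" "lin_indpt B" "gen_set B" "\<one>\<^bsub>R\<^esub> \<noteq> \<zero>\<^bsub>R\<^esub>"
  shows "nondegenerate_simplicial_map (Pow B) line_complex (\<lambda>b. span {b})"
proof -
  have inj: "inj_on (\<lambda>b. span {b}) B"
  proof (rule inj_onI, rule ccontr)
    fix v w assume vw: "v \<in> B" "w \<in> B" "span {v} = span {w}" "v \<noteq> w"
    have "v \<in> span {v}" using in_own_span[of "{v}"] vw assms by blast
    then have "v \<in> span {v} \<inter> span {w}" using vw by simp
    then have "v = \<zero>\<^bsub>M\<^esub>"
      using span_Int_span_disjoint[OF assms(1-3), of "{v}" "{w}"] vw by auto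
    moreover have "carrier R \<noteq> {\<zero>\<^bsub>R\<^esub>}" using assms(5) R.one_closed by blast
    ultimately show False using zero_nin_lin_indpt[OF assms(2,3)] vw by blast
  qed
  have lines: "span {b} \<in> lines" if "b \<in> B" for b
  proof -
    have "lin_indpt {b}" using subset_li_is_li[OF assms(3)] that by blast
    then have "has_rank (span {b}) (card {b})"
      using that assms by (intro has_rank_span) auto
    then show ?thesis
      using direct_summand_span_subset_basis[OF assms(1-4), of "{b}"] that
      by (simp add: lines_def)
  qed
  have simplex: "(\<lambda>b. span {b}) ` S \<in> line_complex" if S: "S \<subseteq> B" for S
  proof -
    have "lin_indpt S" using subset_li_is_li[OF assms(3)] S .
    then have "has_rank (span S) (card S)"
      using S assms finite_subset by (intro has_rank_span) auto
    moreover have "card ((\<lambda>b. span {b}) ` S) = card S"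
      using inj S by (intro card_image) (rule inj_on_subset)
    moreover have "span (\<Union>b\<in>S. span {b}) = span S"
      using S assms by (intro span_Union_spans) auto
    ultimately show ?thesis
      unfolding line_complex_def
      using direct_summand_span_subset_basis[OF assms(1-4) S] lines S finite_subset[OF S assms(1)]
      by auto
  qed
  then have "span {b} \<in> vertices line_complex" if "b \<in> B" for b
    using simplex[of "{b}"] that by (auto simp: vertices_def)
  then show ?thesis
    unfolding nondegenerate_simplicial_map_def simplicial_map_def
    using simplex inj inj_on_subset by (fastforce simp: vertices_def)
qed

end

section \<open>Rank bounds over a field\<close>

text \<open>Steinitz exchange: an independent set inside a span is no larger than the spanning
  set.\<close>

lemma (in vectorspace) has_rank_span_le:
  assumes "finite B" "B \<subseteq> carrier V" "N \<subseteq> span B" "has_rank N k"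
  shows "k \<le> card B"
proof -
  obtain A where A: "finite A" "card A = k" "A \<subseteq> carrier V" "lin_indpt A" "span A = N"
    using assms(4) unfolding has_rank_def by blast
  have "A \<subseteq> span B" using in_own_span[OF A(3)] A(5) assms(3) by blast
  from replacement[OF A(1) assms(1,2) A(4) this] A(2) show ?thesis by auto
qed

text \<open>One generator per line already spans everything. Read backwards, a large rank forces
  many distinct lines.\<close>

lemma (in vectorspace) has_rank_span_lines_le:
  assumes "finite T" "T \<subseteq> lines" "has_rank (span (\<Union>T)) k"
  shows "k \<le> card T"
proof -
  have "\<exists>v. v \<in> carrier V \<and> span {v} = l" if l: "l \<in> lines" for l
  proof -
    obtain B where "card B = 1" "B \<subseteq> carrier V" "span B = l"
      using l unfolding lines_def has_rank_def by auto
    then show ?thesis by (auto simp: card_1_singleton_iff)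
  qed
  then obtain v where v: "\<And>l. l \<in> lines \<Longrightarrow> v l \<in> carrier V \<and> span {v l} = l"
    by metis
  have sub: "v ` T \<subseteq> carrier V" using v assms(2) by blast
  have "\<Union>T = (\<Union>x\<in>v ` T. span {x})" using v assms(2) by auto
  then have "span (\<Union>T) = span (v ` T)" using span_Union_spans[OF sub] by simp
  then have "k \<le> card (v ` T)"
    using has_rank_span_le[OF _ sub _ assms(3)] assms(1) by simp
  also have "\<dots> \<le> card T" using assms(1) by (rule card_image_le)
  finally show ?thesis .
qed

section \<open>Reduction of a module modulo \<pi> to a vector space\<close>

text \<open>
  The model is \<open>\<rho> : \<int>\<^sup>r \<rightarrow> F\<^sub>p\<^sup>r\<close>, which is semilinear over \<open>h : \<int> \<rightarrow> F\<^sub>p\<close>, with \<open>\<pi> = p\<close>.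
\<close>

locale module_reduction =
  M: Module.module R M + V: vectorspace K V for R M K V +
  fixes \<pi> h \<rho>
  assumes uniformizer_closed: "\<pi> \<in> carrier R"
    and h_closed: "a \<in> carrier R \<Longrightarrow> h a \<in> carrier K"
    and h_surj: "c \<in> carrier K \<Longrightarrow> \<exists>a\<in>carrier R. h a = c"
    and h_one: "h \<one>\<^bsub>R\<^esub> = \<one>\<^bsub>K\<^esub>"
    and h_uniformizer: "a \<in> carrier R \<Longrightarrow> h (\<pi> \<otimes>\<^bsub>R\<^esub> a) = \<zero>\<^bsub>K\<^esub>"
    and rho_closed: "v \<in> carrier M \<Longrightarrow> \<rho> v \<in> carrier V"
    and rho_surj: "\<rho> ` carrier M = carrier V"
    and rho_add: "v \<in> carrier M \<Longrightarrow> w \<in> carrier M \<Longrightarrow> \<rho> (v \<oplus>\<^bsub>M\<^esub> w) = \<rho> v \<oplus>\<^bsub>V\<^esub> \<rho> w"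
    and rho_smult: "a \<in> carrier R \<Longrightarrow> v \<in> carrier M \<Longrightarrow> \<rho> (a \<odot>\<^bsub>M\<^esub> v) = h a \<odot>\<^bsub>V\<^esub> \<rho> v"
    and rho_kernel: "v \<in> carrier M \<Longrightarrow> \<rho> v = \<zero>\<^bsub>V\<^esub> \<Longrightarrow> \<exists>w\<in>carrier M. v = \<pi> \<odot>\<^bsub>M\<^esub> w"
begin

lemma rho_zero: "\<rho> \<zero>\<^bsub>M\<^esub> = \<zero>\<^bsub>V\<^esub>"
proof -
  have "\<rho> \<zero>\<^bsub>M\<^esub> \<oplus>\<^bsub>V\<^esub> \<rho> \<zero>\<^bsub>M\<^esub> = \<rho> \<zero>\<^bsub>M\<^esub>"
    using rho_add[of "\<zero>\<^bsub>M\<^esub>" "\<zero>\<^bsub>M\<^esub>"] by simp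
  then show ?thesis using rho_closed[of "\<zero>\<^bsub>M\<^esub>"] by (simp add: V.M.add.l_cancel_one)
qed

lemma rho_minus:
  assumes "v \<in> carrier M" "w \<in> carrier M"
  shows "\<rho> (v \<ominus>\<^bsub>M\<^esub> w) = \<rho> v \<ominus>\<^bsub>V\<^esub> \<rho> w"
proof -
  have "\<rho> w \<oplus>\<^bsub>V\<^esub> \<rho> (\<ominus>\<^bsub>M\<^esub> w) = \<zero>\<^bsub>V\<^esub>"
    using rho_add[of w "\<ominus>\<^bsub>M\<^esub> w"] assms by (simp add: M.M.r_neg rho_zero)
  then have "\<rho> (\<ominus>\<^bsub>M\<^esub> w) = \<ominus>\<^bsub>V\<^esub> \<rho> w"
    using assms rho_closed by (metis V.M.a_comm V.M.minus_equality M.M.a_inv_closed)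
  then show ?thesis using assms by (simp add: rho_add a_minus_def)
qed

text \<open>The sum runs over \<open>A\<close> and not over its image, since \<rho> need not be
  injective on \<open>A\<close>. It is reindexed over the image once injectivity is known.\<close>

lemma rho_lincomb:
  assumes "finite A" "A \<subseteq> carrier M" "a \<in> A \<rightarrow> carrier R"
  shows "\<rho> (M.lincomb a A) = (\<Oplus>\<^bsub>V\<^esub>v\<in>A. h (a v) \<odot>\<^bsub>V\<^esub> \<rho> v)"
  using assms
proof (induction A rule: finite_induct)
  case empty
  then show ?case by (simp add: M.lincomb_def rho_zero)
next
  case (insert v A)
  have "M.lincomb a (insert v A) = a v \<odot>\<^bsub>M\<^esub> v \<oplus>\<^bsub>M\<^esub> M.lincomb a A"
    using M.lincomb_insert[of A a v] insert by auto
  moreover have "a \<in> A \<rightarrow> carrier R" "A \<subseteq> carrier M" using insert by auto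
  ultimately show ?case
    using insert
    by (simp add: rho_add rho_smult V.M.finsum_insert h_closed rho_closed Pi_def subset_eq)
qed

text \<open>Closure under scalars of \<open>K\<close> holds because each of them lifts to
  \<open>R\<close> along \<open>h\<close>.\<close>

lemma submodule_image:
  assumes "submodule R N M"
  shows "submodule K (\<rho> ` N) V"
proof -
  interpret N: LinearCombinations.submodule R N M by fact
  note sub = subsetD[OF N.subset]
  show ?thesis
  proof (rule LinearCombinations.submodule.intro)
    show "Module.module K V" by (rule V.module_axioms)
    show "\<rho> ` N \<subseteq> carrier V" using sub rho_closed by blast
    show "v \<oplus>\<^bsub>V\<^esub> w \<in> \<rho> ` N" if "v \<in> \<rho> ` N" "w \<in> \<rho> ` N" for v w
      using that by (auto simp: sub rho_add[symmetric])
    show "\<zero>\<^bsub>V\<^esub> \<in> \<rho> ` N" using N.zero_closed rho_zero by (metis imageI)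
    show "c \<odot>\<^bsub>V\<^esub> v \<in> \<rho> ` N" if c: "c \<in> carrier K" and v: "v \<in> \<rho> ` N" for c v
    proof -
      obtain a where "a \<in> carrier R" "h a = c" using h_surj[OF c] by blast
      with v show ?thesis by (auto simp: sub rho_smult[symmetric])
    qed
  qed
qed

text \<open>The preimage of the span on the right is a submodule containing \<open>S\<close>, which
  gives one inclusion; the image of a submodule is a submodule, which gives the other.\<close>

lemma image_span:
  assumes "S \<subseteq> carrier M"
  shows "\<rho> ` M.span S = V.span (\<rho> ` S)"
proof
  have sub: "\<rho> ` S \<subseteq> carrier V" using assms rho_closed by blast
  interpret W: LinearCombinations.submodule K "V.span (\<rho> ` S)" V
    using V.span_is_submodule[OF sub] .
  have "submodule R {v \<in> carrier M. \<rho> v \<in> V.span (\<rho> ` S)} M"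
    by (rule LinearCombinations.submodule.intro)
      (auto simp: rho_add rho_smult rho_zero h_closed intro: M.module_axioms)
  moreover have "S \<subseteq> {v \<in> carrier M. \<rho> v \<in> V.span (\<rho> ` S)}"
    using assms V.in_own_span[OF sub] by blast
  ultimately have "M.span S \<subseteq> {v \<in> carrier M. \<rho> v \<in> V.span (\<rho> ` S)}"
    by (intro M.span_is_subset)
  then show "\<rho> ` M.span S \<subseteq> V.span (\<rho> ` S)" by blast
  show "V.span (\<rho> ` S) \<subseteq> \<rho> ` M.span S"
    using M.in_own_span[OF assms]
    by (intro V.span_is_subset submodule_image M.span_is_submodule assms) auto
qed

text \<open>An element of \<open>N\<close> divisible by \<pi> in \<open>M\<close> is divisible by
  \<pi> within \<open>N\<close>. Split the quotient as \<open>n + n'\<close> along a complement: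
  then \<pi> times \<open>n'\<close> lies in both \<open>N\<close> and \<open>N'\<close>, hence is
  zero.\<close>

lemma direct_summand_kernel:
  assumes "M.direct_summand N" "v \<in> N" "\<rho> v = \<zero>\<^bsub>V\<^esub>"
  shows "\<exists>n\<in>N. v = \<pi> \<odot>\<^bsub>M\<^esub> n"
proof -
  obtain N' where N: "submodule R N M" "submodule R N' M"
    and int: "N \<inter> N' = {\<zero>\<^bsub>M\<^esub>}" and sum: "M.submodule_sum N N' = carrier M"
    using assms(1) unfolding M.direct_summand_def by blast
  interpret N: LinearCombinations.submodule R N M by fact
  interpret N': LinearCombinations.submodule R N' M by fact
  have v: "v \<in> carrier M" using assms N.subset by blast
  then obtain w where w: "w \<in> carrier M" "v = \<pi> \<odot>\<^bsub>M\<^esub> w" using rho_kernel assms by blast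
  then obtain n n' where n: "n \<in> N" "n' \<in> N'" "w = n \<oplus>\<^bsub>M\<^esub> n'"
    using sum M.submodule_sumE by metis
  have c: "n \<in> carrier M" "n' \<in> carrier M" using n N.subset N'.subset by blast+
  have eq: "v = \<pi> \<odot>\<^bsub>M\<^esub> n \<oplus>\<^bsub>M\<^esub> \<pi> \<odot>\<^bsub>M\<^esub> n'"
    using w n c uniformizer_closed by (simp add: M.smult_r_distr)
  then have "\<pi> \<odot>\<^bsub>M\<^esub> n' = v \<ominus>\<^bsub>M\<^esub> \<pi> \<odot>\<^bsub>M\<^esub> n"
    using c uniformizer_closed by (simp add: M.M.add_minus_cancel_left)
  also have "\<dots> \<in> N"
    using M.submodule_minus_closed[OF N(1)] assms n uniformizer_closed by blast
  finally have "\<pi> \<odot>\<^bsub>M\<^esub> n' \<in> N \<inter> N'" using n uniformizer_closed by simp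
  then have "\<pi> \<odot>\<^bsub>M\<^esub> n' = \<zero>\<^bsub>M\<^esub>" using int by blast
  then show ?thesis using eq c n uniformizer_closed by auto
qed

text \<open>The image of a complement of \<open>N\<close> is a complement of the image. Only the
  trivial intersection takes work; the sum is everything because \<rho> is surjective.\<close>

lemma direct_summand_image:
  assumes "M.direct_summand N"
  shows "V.direct_summand (\<rho> ` N)"
proof -
  obtain N' where N: "submodule R N M" "submodule R N' M"
    and int: "N \<inter> N' = {\<zero>\<^bsub>M\<^esub>}" and sum: "M.submodule_sum N N' = carrier M"
    using assms(1) unfolding M.direct_summand_def by blast
  interpret N: LinearCombinations.submodule R N M by fact
  interpret N': LinearCombinations.submodule R N' M by fact
  note sub = subsetD[OF N.subset] subsetD[OF N'.subset]
  have "x = \<zero>\<^bsub>V\<^esub>" if x: "x \<in> \<rho> ` N" "x \<in> \<rho> ` N'" for x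
  proof -
    obtain n n' where n: "n \<in> N" "n' \<in> N'" "x = \<rho> n" "x = \<rho> n'" using x by blast
    have "\<rho> (n \<ominus>\<^bsub>M\<^esub> n') = \<zero>\<^bsub>V\<^esub>"
      using n sub rho_closed rho_minus[of n n'] by (simp add: V.M.r_neg a_minus_def)
    then obtain w where w: "w \<in> carrier M" "n \<ominus>\<^bsub>M\<^esub> n' = \<pi> \<odot>\<^bsub>M\<^esub> w"
      using rho_kernel n sub by (meson M.M.minus_closed)
    then obtain q q' where q: "q \<in> N" "q' \<in> N'" "w = q \<oplus>\<^bsub>M\<^esub> q'"
      using sum M.submodule_sumE by metis
    \<comment> \<open>Splitting \<open>w\<close> turns \<open>n - n' = \<pi> w\<close> into
      \<open>n - \<pi> q = n' + \<pi> q'\<close>. The left side lies in \<open>N\<close> and the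
      right side in \<open>N'\<close>, so both vanish and \<open>n\<close> is a multiple of
      \<pi>.\<close>
    define y where "y = n \<ominus>\<^bsub>M\<^esub> \<pi> \<odot>\<^bsub>M\<^esub> q"
    have pc: "\<pi> \<odot>\<^bsub>M\<^esub> q \<in> N" "\<pi> \<odot>\<^bsub>M\<^esub> q' \<in> N'" using q uniformizer_closed by simp_all
    have "n = (n \<ominus>\<^bsub>M\<^esub> n') \<oplus>\<^bsub>M\<^esub> n'"
      using n sub by (simp add: a_minus_def M.M.a_assoc M.M.l_neg)
    also have "\<dots> = \<pi> \<odot>\<^bsub>M\<^esub> q \<oplus>\<^bsub>M\<^esub> (\<pi> \<odot>\<^bsub>M\<^esub> q' \<oplus>\<^bsub>M\<^esub> n')"
      using w q n sub uniformizer_closed by (simp add: M.smult_r_distr M.M.a_assoc)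
    finally have "y = \<pi> \<odot>\<^bsub>M\<^esub> q' \<oplus>\<^bsub>M\<^esub> n'"
      unfolding y_def using n sub pc M.M.add_minus_cancel_left by simp
    then have "y \<in> N'" using pc n by simp
    moreover have "y \<in> N" unfolding y_def using M.submodule_minus_closed[OF N(1)] n pc by blast
    ultimately have "y = \<zero>\<^bsub>M\<^esub>" using int by blast
    then have "n = \<pi> \<odot>\<^bsub>M\<^esub> q" unfolding y_def using n pc sub by simp
    then have "\<rho> n = h \<pi> \<odot>\<^bsub>V\<^esub> \<rho> q" using q sub rho_smult uniformizer_closed by simp
    moreover have "h \<pi> = \<zero>\<^bsub>K\<^esub>" using h_uniformizer[of "\<one>\<^bsub>R\<^esub>"] uniformizer_closed by simp
    ultimately show ?thesis using n q sub rho_closed by simp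
  qed
  moreover have "\<zero>\<^bsub>V\<^esub> \<in> \<rho> ` N" "\<zero>\<^bsub>V\<^esub> \<in> \<rho> ` N'"
    using N.zero_closed N'.zero_closed rho_zero by (metis imageI)+
  moreover have "V.submodule_sum (\<rho> ` N) (\<rho> ` N') = carrier V"
  proof -
    have "x \<in> V.submodule_sum (\<rho> ` N) (\<rho> ` N')" if "x \<in> carrier V" for x
    proof -
      have "x \<in> \<rho> ` M.submodule_sum N N'" using that by (simp add: sum rho_surj)
      then obtain v where v: "v \<in> M.submodule_sum N N'" "x = \<rho> v" by (rule imageE)
      from v(1) obtain n n' where "n \<in> N" "n' \<in> N'" "v = n \<oplus>\<^bsub>M\<^esub> n'"
        by (rule M.submodule_sumE)
      then show ?thesis
        using v(2) sub by (auto simp: V.submodule_sum_def rho_add)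
    qed
    moreover have "V.submodule_sum (\<rho> ` N) (\<rho> ` N') \<subseteq> carrier V"
      using sub rho_closed by (auto simp: V.submodule_sum_def)
    ultimately show ?thesis by (auto del: subsetI intro!: equalityI intro: subsetI)
  qed
  ultimately show ?thesis
    unfolding V.direct_summand_def
    using submodule_image[OF N(1)] submodule_image[OF N(2)] by blast
qed

text \<open>This is how independence survives reduction. A combination that reduces to zero is \<pi>
  times an element of the span of \<open>B\<close>, and comparing coefficients over the independent
  set \<open>B\<close> shows that each \<open>a v\<close> is a multiple of \<pi>.\<close>

lemma reduced_coefficients_zero:
  assumes "M.direct_summand (M.span B)" "finite B" "B \<subseteq> carrier M" "M.lin_indpt B"
    and a: "a \<in> B \<rightarrow> carrier R" "\<rho> (M.lincomb a B) = \<zero>\<^bsub>V\<^esub>" and v: "v \<in> B"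
  shows "h (a v) = \<zero>\<^bsub>K\<^esub>"
proof -
  have "M.lincomb a B \<in> M.span B" using M.finite_span[OF assms(2,3)] a by blast
  then obtain n where n: "n \<in> M.span B" "M.lincomb a B = \<pi> \<odot>\<^bsub>M\<^esub> n"
    using direct_summand_kernel[OF assms(1)] a by blast
  then obtain b where b: "b \<in> B \<rightarrow> carrier R" "M.lincomb b B = n"
    using M.finite_in_span[OF assms(2,3)] by blast
  have pb: "(\<lambda>v. \<pi> \<otimes>\<^bsub>R\<^esub> b v) \<in> B \<rightarrow> carrier R" using b uniformizer_closed by auto
  have "M.lincomb (\<lambda>v. \<pi> \<otimes>\<^bsub>R\<^esub> b v) B = M.lincomb a B"
    using M.lincomb_smult[OF assms(3) b(1) uniformizer_closed] b n by simp
  then have "M.lincomb (\<lambda>v. a v \<ominus>\<^bsub>R\<^esub> \<pi> \<otimes>\<^bsub>R\<^esub> b v) B = \<zero>\<^bsub>M\<^esub>"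
    using M.lincomb_diff[OF assms(2,3) a(1) pb] M.lincomb_closed[OF assms(3) a(1)]
    by (simp add: a_minus_def M.M.r_neg)
  moreover have "(\<lambda>v. a v \<ominus>\<^bsub>R\<^esub> \<pi> \<otimes>\<^bsub>R\<^esub> b v) \<in> B \<rightarrow> carrier R" using a(1) pb by auto
  ultimately have "a v \<ominus>\<^bsub>R\<^esub> \<pi> \<otimes>\<^bsub>R\<^esub> b v = \<zero>\<^bsub>R\<^esub>"
    using M.lin_dep_crit[OF assms(2) subset_refl] v assms(4) by blast
  moreover have "a v \<in> carrier R" "\<pi> \<otimes>\<^bsub>R\<^esub> b v \<in> carrier R" "b v \<in> carrier R"
    using a(1) b(1) uniformizer_closed v by auto
  ultimately have "a v = \<pi> \<otimes>\<^bsub>R\<^esub> b v" by simp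
  then show ?thesis using h_uniformizer \<open>b v \<in> carrier R\<close> by simp
qed

text \<open>A basis of \<open>N\<close> reduces injectively to a basis of the image. Injectivity and
  independence both follow from \<open>reduced_coefficients_zero\<close>.\<close>

lemma has_rank_image:
  assumes "M.direct_summand N" "M.has_rank N k"
  shows "V.has_rank (\<rho> ` N) k"
proof -
  obtain B where B: "finite B" "card B = k" "B \<subseteq> carrier M" "M.lin_indpt B" "M.span B = N"
    using assms(2) unfolding M.has_rank_def by blast
  note zero = reduced_coefficients_zero[OF _ B(1,3,4)]
  have unit: "M.lincomb (\<lambda>x. if x = v then \<one>\<^bsub>R\<^esub> else \<zero>\<^bsub>R\<^esub>) B = v" if "v \<in> B" for v
  proof -
    have "M.lincomb (\<lambda>x. if x = v then \<one>\<^bsub>R\<^esub> else \<zero>\<^bsub>R\<^esub>) (B - {v}) = \<zero>\<^bsub>M\<^esub>"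
      using B by (intro M.lincomb_zero) auto
    then show ?thesis
      using that B by (subst M.lincomb_del2[of B _ v]) auto
  qed
  have inj: "inj_on \<rho> B"
  proof (rule inj_onI, rule ccontr)
    fix v w assume vw: "v \<in> B" "w \<in> B" "\<rho> v = \<rho> w" "v \<noteq> w"
    \<comment> \<open>These are the coefficients of \<open>v - w\<close>. The one at
      \<open>v\<close> is 1, which \<open>h\<close> does not send to zero.\<close>
    let ?a = "\<lambda>x. (if x = v then \<one>\<^bsub>R\<^esub> else \<zero>\<^bsub>R\<^esub>) \<ominus>\<^bsub>R\<^esub> (if x = w then \<one>\<^bsub>R\<^esub> else \<zero>\<^bsub>R\<^esub>)"
    have c: "v \<in> carrier M" "w \<in> carrier M" using vw B by auto
    have "M.lincomb ?a B = v \<ominus>\<^bsub>M\<^esub> w"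
      using M.lincomb_diff[OF B(1,3)] unit vw by simp
    then have "\<rho> (M.lincomb ?a B) = \<zero>\<^bsub>V\<^esub>"
      using vw c rho_closed rho_minus[OF c] by (simp add: a_minus_def V.M.r_neg)
    then have "h (?a v) = \<zero>\<^bsub>K\<^esub>"
      using zero[of ?a v] vw B assms(1) by auto
    moreover have "?a v = \<one>\<^bsub>R\<^esub>" using vw by (simp add: a_minus_def)
    ultimately show False using h_one by simp
  qed
  have sub: "\<rho> ` B \<subseteq> carrier V" using B rho_closed by blast
  have "V.lin_indpt (\<rho> ` B)"
  proof (rule V.finite_lin_indpt2)
    fix c assume c: "c \<in> \<rho> ` B \<rightarrow> carrier K" "V.lincomb c (\<rho> ` B) = \<zero>\<^bsub>V\<^esub>"
    \<comment> \<open>A relation over \<open>K\<close> among the images is lifted coefficient by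
      coefficient to \<open>R\<close>.\<close>
    have "\<forall>v\<in>B. \<exists>a\<in>carrier R. h a = c (\<rho> v)" using c(1) h_surj by blast
    then obtain a where a: "\<And>v. v \<in> B \<Longrightarrow> a v \<in> carrier R \<and> h (a v) = c (\<rho> v)" by metis
    have "\<rho> (M.lincomb a B) = (\<Oplus>\<^bsub>V\<^esub>v\<in>B. h (a v) \<odot>\<^bsub>V\<^esub> \<rho> v)"
      using a B by (intro rho_lincomb) auto
    also have "\<dots> = (\<Oplus>\<^bsub>V\<^esub>v\<in>B. c (\<rho> v) \<odot>\<^bsub>V\<^esub> \<rho> v)"
      using a c(1) sub by (intro V.M.finsum_cong') (auto simp: Pi_def intro!: V.smult_closed)
    also have "\<dots> = V.lincomb c (\<rho> ` B)"
      unfolding V.lincomb_def using c(1) sub by (intro V.M.finsum_reindex[symmetric] inj) (auto simp: Pi_def)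
    finally have "\<rho> (M.lincomb a B) = \<zero>\<^bsub>V\<^esub>" using c by simp
    then have "h (a v) = \<zero>\<^bsub>K\<^esub>" if "v \<in> B" for v
      using zero[of a v] that a assms(1) B by auto
    then show "\<forall>v\<in>\<rho> ` B. c v = \<zero>\<^bsub>K\<^esub>" using a by auto
  qed (use B sub in auto)
  then have "V.has_rank (V.span (\<rho> ` B)) (card (\<rho> ` B))"
    using B sub by (intro V.has_rank_span) auto
  then show ?thesis using image_span[OF B(3)] card_image[OF inj] B by simp
qed

text \<open>Direct summands and ranks are preserved, both for single lines and for the span of a
  whole simplex. Equality of ranks is what yields nondegeneracy.\<close>

lemma nondegenerate_image:
  "nondegenerate_simplicial_map M.line_complex V.line_complex ((`) \<rho>)"
proof -
  have lines: "\<rho> ` l \<in> V.lines" if "l \<in> M.lines" for l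
    using that direct_summand_image has_rank_image by (simp add: M.lines_def V.lines_def)
  have *: "(`) \<rho> ` S \<in> V.line_complex \<and> inj_on ((`) \<rho>) S" if S: "S \<in> M.line_complex" for S
  proof -
    have S': "finite S" "S \<subseteq> M.lines" "M.direct_summand (M.span (\<Union>S))"
      "M.has_rank (M.span (\<Union>S)) (card S)"
      using S by (auto simp: M.line_complex_def)
    have "l \<subseteq> carrier M" if "l \<in> M.lines" for l
      using that LinearCombinations.submodule.subset
      by (auto simp: M.lines_def M.direct_summand_def)
    then have "\<Union>S \<subseteq> carrier M" using S' by blast
    then have eq: "V.span (\<Union>((`) \<rho> ` S)) = \<rho> ` M.span (\<Union>S)"
      using image_span[of "\<Union>S"] by (simp add: image_Union)
    have rank: "V.has_rank (V.span (\<Union>((`) \<rho> ` S))) (card S)"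
      using has_rank_image S' eq by simp
    \<comment> \<open>The image lines span a space of dimension \<open>card S\<close>, so no two of them coincide.\<close>
    have "card S \<le> card ((`) \<rho> ` S)"
      using S' lines by (intro V.has_rank_span_lines_le rank) auto
    then have "card ((`) \<rho> ` S) = card S" using card_image_le[OF S'(1)] by (meson le_antisym)
    then show ?thesis
      using rank S' lines eq direct_summand_image
      by (auto simp: V.line_complex_def eq_card_imp_inj_on)
  qed
  then have "(`) \<rho> ` vertices M.line_complex \<subseteq> vertices V.line_complex"
    unfolding vertices_def by blast
  then show ?thesis
    using * by (simp add: nondegenerate_simplicial_map_def simplicial_map_def)
qed

end

section \<open>Composition of nondegenerate maps, and the coordinate lines of a free module\<close>

lemma nondegenerate_simplicial_map_comp:
  assumes f: "nondegenerate_simplicial_map K L f" and g: "nondegenerate_simplicial_map L N g"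
  shows "nondegenerate_simplicial_map K N (g \<circ> f)"
proof -
  have "inj_on (g \<circ> f) \<sigma>" "(g \<circ> f) ` \<sigma> \<in> N" if "\<sigma> \<in> K" for \<sigma>
    using assms that unfolding nondegenerate_simplicial_map_def simplicial_map_def image_comp[symmetric]
    by (auto intro: comp_inj_on)
  moreover have "(g \<circ> f) ` vertices K \<subseteq> vertices N"
    using assms unfolding nondegenerate_simplicial_map_def simplicial_map_def image_comp[symmetric]
    by (meson image_mono order_trans)
  ultimately show ?thesis
    by (simp add: nondegenerate_simplicial_map_def simplicial_map_def)
qed

text \<open>The standard basis vectors; restricting to \<open>S\<close> makes them extensional, as
  the carrier of \<open>func_space\<close> requires.\<close>

definition (in ring) unit_fun :: "'z set \<Rightarrow> 'z \<Rightarrow> 'z \<Rightarrow> 'a" where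
  "unit_fun S i = (\<lambda>j\<in>S. if j = i then \<one> else \<zero>)"

lemma (in ring) unit_fun_closed: "unit_fun S i \<in> carrier (func_space S)"
  by (simp add: unit_fun_def func_space_def)

lemma (in ring) inj_on_unit_fun:
  assumes "\<one> \<noteq> \<zero>"
  shows "inj_on (unit_fun S) S"
proof (rule inj_onI)
  fix i j assume i: "i \<in> S" and "j \<in> S" and eq: "unit_fun S i = unit_fun S j"
  have "(if i = i then \<one> else \<zero>) = (if i = j then \<one> else \<zero>)"
    using fun_cong[OF eq, of i] i by (simp add: unit_fun_def)
  then show "i = j" using assms by (auto split: if_splits)
qed

text \<open>The coefficients reappear as the values of the combination. The induction is over a
  subset \<open>T\<close> with the ambient \<open>S\<close> fixed; \<open>inj_on_unit_fun\<close>
  ensures that each step adds a new vector.\<close>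

lemma (in cring) lincomb_unit_fun:
  assumes "\<one> \<noteq> \<zero>" "finite T" "T \<subseteq> S" "a \<in> unit_fun S ` T \<rightarrow> carrier R"
  shows "module.lincomb (func_space S) a (unit_fun S ` T) =
    (\<lambda>j\<in>S. if j \<in> T then a (unit_fun S j) else \<zero>)"
  using assms(2-)
proof (induction T rule: finite_induct)
  interpret F: Module.module R "func_space S" by (rule func_space_is_module)
  case empty
  show ?case by (simp add: F.lincomb_def) (simp add: func_space_def)
next
  interpret F: Module.module R "func_space S" by (rule func_space_is_module)
  case (insert i T)
  have notin: "unit_fun S i \<notin> unit_fun S ` T"
    using insert inj_on_unit_fun[OF assms(1), of S] by (auto dest: inj_onD)
  have ai: "a (unit_fun S i) \<in> carrier R" using insert by auto
  have aT: "a (unit_fun S j) \<in> carrier R" if "j \<in> T" for j using insert that by auto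
  have "F.lincomb a (insert (unit_fun S i) (unit_fun S ` T)) =
      a (unit_fun S i) \<odot>\<^bsub>func_space S\<^esub> unit_fun S i
        \<oplus>\<^bsub>func_space S\<^esub> F.lincomb a (unit_fun S ` T)"
    using insert notin by (intro F.lincomb_insert2) (auto simp: unit_fun_closed)
  also have "F.lincomb a (unit_fun S ` T) = (\<lambda>j\<in>S. if j \<in> T then a (unit_fun S j) else \<zero>)"
    using insert by auto
  also have "a (unit_fun S i) \<odot>\<^bsub>func_space S\<^esub> unit_fun S i \<oplus>\<^bsub>func_space S\<^esub> \<dots> =
      (\<lambda>j\<in>S. if j \<in> insert i T then a (unit_fun S j) else \<zero>)"
  proof -
    have "a (unit_fun S i) \<otimes> (if j = i then \<one> else \<zero>) \<oplus> (if j \<in> T then a (unit_fun S j) else \<zero>) =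
        (if j \<in> insert i T then a (unit_fun S j) else \<zero>)" for j
      using insert(2) ai aT by auto
    then show ?thesis
      unfolding func_space_def unit_fun_def[of S i] by (auto simp: restrict_def fun_eq_iff)
  qed
  finally show ?case by simp
qed

lemma (in cring) func_space_basis:
  assumes "\<one> \<noteq> \<zero>" "finite S"
  shows "\<not> LinearCombinations.module.lin_dep R (func_space S) (unit_fun S ` S)"
    and "LinearCombinations.module.span R (func_space S) (unit_fun S ` S) = carrier (func_space S)"
proof -
  interpret F: Module.module R "func_space S" by (rule func_space_is_module)
  have sub: "unit_fun S ` S \<subseteq> carrier (func_space S)"
    by (auto intro: unit_fun_closed)
  note lc = lincomb_unit_fun[OF assms subset_refl]
  show "F.lin_indpt (unit_fun S ` S)"
  proof (rule F.finite_lin_indpt2)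
    fix a assume a: "a \<in> unit_fun S ` S \<rightarrow> carrier R"
      "F.lincomb a (unit_fun S ` S) = \<zero>\<^bsub>func_space S\<^esub>"
    have "(\<lambda>j\<in>S. if j \<in> S then a (unit_fun S j) else \<zero>) = (\<lambda>j\<in>S. \<zero>)"
      using a(2) unfolding lc[OF a(1)] by (simp add: func_space_def)
    then have "a (unit_fun S j) = \<zero>" if "j \<in> S" for j
      using that by (metis (mono_tags, lifting) restrict_apply')
    then show "\<forall>v\<in>unit_fun S ` S. a v = \<zero>" by blast
  qed (use assms sub in auto)
  have "v \<in> F.span (unit_fun S ` S)" if v: "v \<in> carrier (func_space S)" for v
  proof -
    \<comment> \<open>Coefficients are indexed by vectors, so the coordinate is recovered by
      inverting \<open>unit_fun\<close>.\<close>
    define a where "a = (\<lambda>x. v (the_inv_into S (unit_fun S) x))"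
    have a: "a (unit_fun S j) = v j" if "j \<in> S" for j
      using that inj_on_unit_fun[OF assms(1), of S] by (simp add: a_def the_inv_into_f_f)
    have v': "v \<in> S \<rightarrow>\<^sub>E carrier R" using v by (simp add: func_space_def)
    then have ac: "a \<in> unit_fun S ` S \<rightarrow> carrier R" using a by auto
    have "F.lincomb a (unit_fun S ` S) = v"
      unfolding lc[OF ac] using a v' by (auto simp: fun_eq_iff PiE_def extensional_def)
    then show ?thesis using ac F.finite_span[OF _ sub] assms(2) by blast
  qed
  then show "F.span (unit_fun S ` S) = carrier (func_space S)"
    using F.span_is_subset2[OF sub] by blast
qed

text \<open>The map factors through the full simplex on the standard basis, each basis vector going
  to the line it spans.\<close>

lemma (in cring) nondegenerate_full_simplex_universal:
  assumes "\<one> \<noteq> \<zero>"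
  shows "\<exists>f. nondegenerate_simplicial_map (full_simplex r) (universal_complex R r) f"
proof -
  let ?S = "{..<r}" and ?e = "unit_fun {..<r}"
  interpret F: Module.module R "func_space ?S" by (rule func_space_is_module)
  have "nondegenerate_simplicial_map (full_simplex r) (Pow (?e ` ?S)) ?e"
    using inj_on_unit_fun[OF assms, of ?S]
    by (auto simp: nondegenerate_simplicial_map_def simplicial_map_def full_simplex_def
        vertices_def intro: inj_on_subset)
  moreover have "nondegenerate_simplicial_map (Pow (?e ` ?S)) F.line_complex (\<lambda>b. F.span {b})"
    using unit_fun_closed func_space_basis[OF assms, of ?S] assms
    by (intro F.nondegenerate_span_basis) auto
  ultimately show ?thesis
    unfolding universal_complex_def using nondegenerate_simplicial_map_comp by blast
qed

text \<open>The span of a simplex has rank equal to its number of lines and sits in a space spanned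
  by at most \<open>r\<close> unit vectors.\<close>

lemma (in field) card_simplex_universal_le:
  assumes "\<sigma> \<in> universal_complex R r"
  shows "card \<sigma> \<le> r"
proof -
  let ?S = "{..<r}" and ?e = "unit_fun {..<r}"
  interpret F: Module.module R "func_space ?S" by (rule func_space_is_module)
  interpret V: vectorspace R "func_space ?S"
    by (intro vectorspace.intro F.module_axioms field_axioms)
  have "F.has_rank (F.span (\<Union>\<sigma>)) (card \<sigma>)" and "\<sigma> \<subseteq> F.lines"
    using assms by (auto simp: universal_complex_def F.line_complex_def)
  moreover have "\<Union>\<sigma> \<subseteq> carrier (func_space ?S)"
    using \<open>\<sigma> \<subseteq> F.lines\<close> LinearCombinations.submodule.subset
    by (fastforce simp: F.lines_def F.direct_summand_def)
  then have "F.span (\<Union>\<sigma>) \<subseteq> F.span (?e ` ?S)"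
    using func_space_basis(2)[OF one_not_zero, of ?S] F.span_is_subset2 by simp
  ultimately have "card \<sigma> \<le> card (?e ` ?S)"
    using unit_fun_closed by (intro V.has_rank_span_le) auto
  also have "\<dots> \<le> r" using card_image_le[of ?S ?e] by simp
  finally show ?thesis .
qed

section \<open>Coordinatewise reduction of integer vectors modulo a prime\<close>

lemma field_residue_ring:
  assumes "prime p"
  shows "field (residue_ring (int p))"
  by (rule residues_prime.is_field) (simp add: residues_prime_def assms)

text \<open>The work is to verify the assumptions of \<open>module_reduction\<close> for
  coordinatewise \<open>mod\<close>; the map on lines is then
  \<open>nondegenerate_image\<close>.\<close>

lemma nondegenerate_universal_mod:
  assumes "prime p"
  shows "\<exists>g. nondegenerate_simplicial_map (universal_complex int_ring r)
    (universal_complex (residue_ring (int p)) r) g"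
proof -
  let ?F = "residue_ring (int p)" and ?S = "{..<r}"
  have p: "int p > 0" using assms prime_gt_0_nat by simp
  interpret k: field ?F by (rule field_residue_ring[OF assms])
  let ?M = "ring.func_space int_ring ?S" and ?V = "k.func_space ?S"
  let ?\<rho> = "\<lambda>f. \<lambda>i\<in>?S. f i mod int p"
  interpret M: Module.module int_ring ?M by (rule cring.func_space_is_module[OF int_is_cring])
  interpret V: Module.module ?F ?V by (rule k.func_space_is_module)
  have M: "carrier ?M = ?S \<rightarrow>\<^sub>E UNIV" "\<And>v w. v \<oplus>\<^bsub>?M\<^esub> w = (\<lambda>i\<in>?S. v i + w i)"
    "\<And>a v. a \<odot>\<^bsub>?M\<^esub> v = (\<lambda>i\<in>?S. a * v i)"
    unfolding ring.func_space_def[OF cring.axioms(1)[OF int_is_cring]] by simp_all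
  have V: "carrier ?V = ?S \<rightarrow>\<^sub>E {0..int p - 1}"
    "\<And>v w. v \<oplus>\<^bsub>?V\<^esub> w = (\<lambda>i\<in>?S. (v i + w i) mod int p)"
    "\<And>a v. a \<odot>\<^bsub>?V\<^esub> v = (\<lambda>i\<in>?S. a * v i mod int p)" "\<zero>\<^bsub>?V\<^esub> = (\<lambda>i\<in>?S. 0)"
    unfolding k.func_space_def by (simp_all add: residue_ring_def)
  have closed: "?\<rho> v \<in> carrier ?V" for v
    unfolding V(1) restrict_PiE_iff using p by simp
  \<comment> \<open>The elements of \<open>?F\<close> are the integers from 0 to
    \<open>p - 1\<close>, so a vector over \<open>?F\<close> is an integer vector that reduces to
    itself. This gives surjectivity.\<close>
  have fixed: "?\<rho> v = v" if v: "v \<in> carrier ?V" for v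
  proof (rule extensionalityI)
    show "v \<in> extensional ?S" using v unfolding V(1) PiE_iff by (rule conjunct2)
    show "?\<rho> v i = v i" if i: "i \<in> ?S" for i
    proof -
      have "v i \<in> {0..int p - 1}" using v i unfolding V(1) by (rule PiE_mem)
      then show ?thesis using i by simp
    qed
  qed (rule restrict_extensional)
  have surj: "?\<rho> ` carrier ?M = carrier ?V"
  proof
    show "?\<rho> ` carrier ?M \<subseteq> carrier ?V" by (rule image_subsetI) (rule closed)
    show "carrier ?V \<subseteq> ?\<rho> ` carrier ?M"
    proof
      fix v assume v: "v \<in> carrier ?V"
      then have "v \<in> carrier ?M" unfolding M(1) V(1) PiE_iff by simp
      with fixed[OF v, symmetric] show "v \<in> ?\<rho> ` carrier ?M" by (rule image_eqI)
    qed
  qed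
  have kernel: "\<exists>w\<in>carrier ?M. v = int p \<odot>\<^bsub>?M\<^esub> w"
    if v: "v \<in> carrier ?M" "?\<rho> v = \<zero>\<^bsub>?V\<^esub>" for v
  proof
    \<comment> \<open>The witness is the coordinatewise quotient, exact because every coordinate has
      residue zero.\<close>
    show "v = int p \<odot>\<^bsub>?M\<^esub> (\<lambda>i\<in>?S. v i div int p)"
      unfolding M(3)
    proof (rule extensionalityI)
      show "v \<in> extensional ?S" using v(1) unfolding M(1) PiE_iff by (rule conjunct2)
      show "v i = (\<lambda>i\<in>?S. int p * (\<lambda>i\<in>?S. v i div int p) i) i" if i: "i \<in> ?S" for i
      proof -
        have "v i mod int p = 0"
          using fun_cong[OF v(2), of i] i unfolding V(4) by simp
        then show ?thesis using i by auto
      qed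
    qed (rule restrict_extensional)
    show "(\<lambda>i\<in>?S. v i div int p) \<in> carrier ?M" unfolding M(1) restrict_PiE_iff by simp
  qed
  have add: "?\<rho> (v \<oplus>\<^bsub>?M\<^esub> w) = ?\<rho> v \<oplus>\<^bsub>?V\<^esub> ?\<rho> w" for v w
    unfolding M(2) V(2) by (rule restrict_ext) (simp add: mod_simps)
  have smult: "?\<rho> (a \<odot>\<^bsub>?M\<^esub> v) = (a mod int p) \<odot>\<^bsub>?V\<^esub> ?\<rho> v" for a v
    unfolding M(3) V(3) by (rule restrict_ext) (simp add: mod_simps)
  interpret module_reduction int_ring ?M ?F ?V "int p" "\<lambda>a. a mod int p" ?\<rho>
  proof (intro module_reduction.intro module_reduction_axioms.intro vectorspace.intro
      M.module_axioms V.module_axioms k.field_axioms closed surj kernel add smult)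
    show "\<exists>a\<in>carrier int_ring. a mod int p = c" if "c \<in> carrier ?F" for c
    proof
      show "c mod int p = c" using that by (simp add: residue_ring_def)
    qed simp
  qed (use p prime_gt_1_nat[OF assms] in \<open>simp_all add: residue_ring_def\<close>)
  show ?thesis
    unfolding universal_complex_def using nondegenerate_image by blast
qed

section \<open>Existence of colourings and the three inequalities\<close>

text \<open>Giving all vertices different colours shows that the minimum defining
  \<open>chromatic_number\<close> is attained.\<close>

lemma nondegenerate_full_simplex_card:
  assumes "finite (vertices K)"
  shows "\<exists>f. nondegenerate_simplicial_map K (full_simplex (card (vertices K))) f"
proof -
  obtain f where "bij_betw f (vertices K) {0..<card (vertices K)}"
    using ex_bij_betw_finite_nat[OF assms] by blast
  then have f: "inj_on f (vertices K)" "f ` vertices K = {..<card (vertices K)}"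
    by (simp_all add: bij_betw_def lessThan_atLeast0)
  have "f ` \<sigma> \<subseteq> {..<card (vertices K)} \<and> inj_on f \<sigma>" if "\<sigma> \<in> K" for \<sigma>
  proof -
    have "\<sigma> \<subseteq> vertices K" using that by (auto simp: vertices_def)
    then show ?thesis using f by (metis image_mono inj_on_subset)
  qed
  moreover have "vertices (full_simplex (card (vertices K))) = {..<card (vertices K)}"
    by (simp add: vertices_def full_simplex_def)
  ultimately have "nondegenerate_simplicial_map K (full_simplex (card (vertices K))) f"
    using f(2) by (simp add: nondegenerate_simplicial_map_def simplicial_map_def full_simplex_def)
  then show ?thesis by blast
qed

theorem corollary5p8:
  fixes K :: "'a set set" and m p :: nat
  assumes "abstract_simplicial_complex K"
    and "finite (vertices K)"
    and "card (vertices K) = m"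
    and "prime p"
  shows "int m - int (chromatic_number K) \<le> buchstaber K \<and>
         buchstaber K \<le> mod_buchstaber p K \<and>
         mod_buchstaber p K \<le> int m - complex_dim K - 1"
proof -
  let ?F = "residue_ring (int p)"
  let ?Z_map = "\<lambda>r. \<exists>f. nondegenerate_simplicial_map K (universal_complex int_ring r) f"
  let ?F_map = "\<lambda>r. \<exists>f. nondegenerate_simplicial_map K (universal_complex ?F r) f"
  interpret k: field ?F by (rule field_residue_ring[OF assms(4)])
  have "\<exists>f. nondegenerate_simplicial_map K (full_simplex (chromatic_number K)) f"
    unfolding chromatic_number_def
    using nondegenerate_full_simplex_card[OF assms(2)] by (rule LeastI)
  moreover have "\<exists>f. nondegenerate_simplicial_map (full_simplex r) (universal_complex int_ring r) f"
    for r
    by (rule cring.nondegenerate_full_simplex_universal[OF int_is_cring]) simp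
  \<comment> \<open>A colouring followed by the coordinate lines. Besides bounding the minimal
    \<open>r\<close> over the integers, this shows that such an \<open>r\<close> exists, which
    \<open>LeastI\<close> needs.\<close>
  ultimately have chi: "?Z_map (chromatic_number K)"
    using nondegenerate_simplicial_map_comp by metis
  then have Z: "?Z_map (LEAST r. ?Z_map r)" by (rule LeastI)
  then have ZF: "?F_map (LEAST r. ?Z_map r)"
    using nondegenerate_universal_mod[OF assms(4)] nondegenerate_simplicial_map_comp by metis
  then have F: "?F_map (LEAST r. ?F_map r)" by (rule LeastI)
  \<comment> \<open>Subtraction from \<open>m\<close> reverses these comparisons of minimal
    ranks.\<close>
  have "(LEAST r. ?Z_map r) \<le> chromatic_number K" using chi by (rule Least_le)
  moreover have "(LEAST r. ?F_map r) \<le> (LEAST r. ?Z_map r)" using ZF by (rule Least_le)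
  moreover have "complex_dim K \<le> int (LEAST r. ?F_map r) - 1"
  proof -
    obtain f where f: "nondegenerate_simplicial_map K (universal_complex ?F (LEAST r. ?F_map r)) f"
      using F by blast
    \<comment> \<open>Injectivity of \<open>f\<close> on \<sigma> makes its image a simplex with
      just as many lines, so the bound over a field applies.\<close>
    have "int (card \<sigma>) - 1 \<le> int (LEAST r. ?F_map r) - 1" if \<sigma>: "\<sigma> \<in> K" for \<sigma>
    proof -
      have "inj_on f \<sigma>" "f ` \<sigma> \<in> universal_complex ?F (LEAST r. ?F_map r)"
        using f \<sigma> by (auto simp: nondegenerate_simplicial_map_def simplicial_map_def)
      then have "card \<sigma> \<le> (LEAST r. ?F_map r)"
        using k.card_simplex_universal_le card_image by metis
      then show ?thesis by simp
    qed
    moreover have "finite K"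
      using assms(2) by (auto simp: vertices_def dest: finite_UnionD)
    moreover have "K \<noteq> {}" using assms(1) by (auto simp: abstract_simplicial_complex_def)
    ultimately show ?thesis unfolding complex_dim_def by (intro Max.boundedI) auto
  qed
  ultimately show ?thesis
    unfolding buchstaber_def mod_buchstaber_def buchstaber_over_def using assms(3) by simp
qed

end
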